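(* For every integer $n\ge 3$, the automorphism group $\operatorname{Aut}(G_n)$ is isomorphic to the dihedral group $D_{5n}$ of order $10n$.
   Context: Let $P$ be the Petersen graph on vertex set $\{0,1,\dots,9\}$ whose 15 edges are the unordered pairs underlying the following set of directed edges (an orientation $\vec P$ of $P$): $E(\vec P)=\{(0,1),(0,4),(0,5),(1,2),(1,6),(2,3),(2,7),(3,4),(3,8),(4,9),(5,7),(5,8),(6,8),(6,9),(7,9)\}$. For $n\ge 3$ let $\sigma$ be the cyclic permutation of $\{1,\dots,n\}$ given by $\sigma(i)=i+1$ for $i<n$ and $\sigma(n)=1$. The graph $G_n$ is the simple undirected graph with vertex set $\{(i,x):1\le i\le n,\ 0\le x\le 9\}$ in which $(i,x)\sim(i,y)$ whenever $\{x,y\}$ is an edge of $P$, and $(i,x)\sim(\sigma(i),y)$ whenever $(x,y)\in E(\vec P)$. Here $D_{m}$ denotes the dihedral group of order $2m$. *)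

theory Defs
  imports "HOL-Algebra.Algebra"
begin

text \<open>
  A simple graph is given by its vertex set and its set of edges, each edge being a
  two-element set of vertices.
\<close>

definition simple_graph :: "'a set \<Rightarrow> 'a set set \<Rightarrow> bool" where
  "simple_graph V E \<longleftrightarrow> (\<forall>e\<in>E. e \<subseteq> V \<and> card e = 2)"

definition graph_auts :: "'a set \<Rightarrow> 'a set set \<Rightarrow> ('a \<Rightarrow> 'a) set" where
  "graph_auts V E = {f \<in> Bij V. \<forall>u\<in>V. \<forall>v\<in>V. {f u, f v} \<in> E \<longleftrightarrow> {u, v} \<in> E}"

definition Aut_graph :: "'a set \<Rightarrow> 'a set set \<Rightarrow> ('a \<Rightarrow> 'a) monoid" where
  "Aut_graph V E = BijGroup V \<lparr>carrier := graph_auts V E\<rparr>"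

text \<open>
  The dihedral group of order \<open>2 * m\<close> (for \<open>m \<ge> 1\<close>) as the semidirect product of the
  integers modulo \<open>m\<close> with the group of order two acting by negation: \<open>(a, s)\<close> stands
  for the map \<open>x \<mapsto> a + x\<close> if \<open>s\<close> is \<open>False\<close> and for \<open>x \<mapsto> a - x\<close> if \<open>s\<close> is \<open>True\<close>,
  and multiplication is composition of these maps.
\<close>

definition dihedral_group :: "nat \<Rightarrow> (int \<times> bool) monoid" where
  "dihedral_group m =
    \<lparr>carrier = {0..<int m} \<times> UNIV,
     monoid.mult = (\<lambda>(a, s) (b, t). ((if s then a - b else a + b) mod int m, s \<noteq> t)),
     one = (0, False)\<rparr>"

definition petersen_arcs :: "(nat \<times> nat) set" where
  "petersen_arcs =
    {(0,1), (0,4), (0,5), (1,2), (1,6), (2,3), (2,7), (3,4), (3,8), (4,9),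
     (5,7), (5,8), (6,8), (6,9), (7,9)}"

definition petersen_edges :: "nat set set" where
  "petersen_edges = {{x, y} | x y. (x, y) \<in> petersen_arcs}"

definition cyc :: "nat \<Rightarrow> nat \<Rightarrow> nat" where
  "cyc n i = (if i < n then i + 1 else 1)"

definition G_verts :: "nat \<Rightarrow> (nat \<times> nat) set" where
  "G_verts n = {1..n} \<times> {0..9}"

definition G_edges :: "nat \<Rightarrow> (nat \<times> nat) set set" where
  "G_edges n =
    {{(i, x), (i, y)} | i x y. i \<in> {1..n} \<and> {x, y} \<in> petersen_edges} \<union>
    {{(i, x), (cyc n i, y)} | i x y. i \<in> {1..n} \<and> (x, y) \<in> petersen_arcs}"

lemma petersen_arcs_bounds:
  assumes "(x, y) \<in> petersen_arcs"
  shows "x \<le> 9" "y \<le> 9" "x \<noteq> y"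
  using assms by (auto simp: petersen_arcs_def)

lemma petersen_edges_bounds:
  assumes "{x, y} \<in> petersen_edges"
  shows "x \<le> 9" "y \<le> 9" "x \<noteq> y"
proof -
  obtain a b where "{x, y} = {a, b}" and ab: "(a, b) \<in> petersen_arcs"
    using assms unfolding petersen_edges_def by blast
  then show "x \<le> 9" "y \<le> 9" "x \<noteq> y"
    using petersen_arcs_bounds[OF ab] by (auto simp: doubleton_eq_iff)
qed

lemma cyc_bounds:
  assumes "n \<ge> 3" "i \<in> {1..n}"
  shows "cyc n i \<in> {1..n}" "cyc n i \<noteq> i"
  using assms by (auto simp: cyc_def)

lemma simple_graph_G:
  assumes "n \<ge> 3"
  shows "simple_graph (G_verts n) (G_edges n)"
  unfolding simple_graph_def
proof
  fix e assume "e \<in> G_edges n"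
  then consider
      (same) i x y where "e = {(i, x), (i, y)}" "i \<in> {1..n}" "{x, y} \<in> petersen_edges"
    | (next_copy) i x y where "e = {(i, x), (cyc n i, y)}" "i \<in> {1..n}" "(x, y) \<in> petersen_arcs"
    unfolding G_edges_def by blast
  then show "e \<subseteq> G_verts n \<and> card e = 2"
  proof cases
    case same
    then show ?thesis using petersen_edges_bounds[OF same(3)] by (simp add: G_verts_def)
  next
    case next_copy
    then show ?thesis
      using petersen_arcs_bounds[OF next_copy(3)] cyc_bounds[OF assms next_copy(2)]
      by (simp add: G_verts_def)
  qed
qed

lemma group_Aut_graph: "group (Aut_graph V E)"
proof -
  interpret B: group "BijGroup V" by (rule group_BijGroup)
  have "subgroup (graph_auts V E) (BijGroup V)"
  proof (rule B.subgroupI)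
    show "graph_auts V E \<subseteq> carrier (BijGroup V)"
      by (auto simp: graph_auts_def BijGroup_def)
    show "graph_auts V E \<noteq> {}"
      using id_Bij[of V] by (auto simp: graph_auts_def intro!: exI[of _ "\<lambda>x\<in>V. x"])
  next
    fix f assume f: "f \<in> graph_auts V E"
    then have fB: "f \<in> Bij V" by (simp add: graph_auts_def)
    have mem: "inv_into V f u \<in> V" "f (inv_into V f u) = u" if "u \<in> V" for u
      using fB that by (auto simp: Bij_inv_into_mem Bij_def bij_betw_def f_inv_into_f)
    have "{inv_into V f u, inv_into V f v} \<in> E \<longleftrightarrow> {u, v} \<in> E" if "u \<in> V" "v \<in> V" for u v
    proof -
      have "{f (inv_into V f u), f (inv_into V f v)} \<in> E \<longleftrightarrow> {inv_into V f u, inv_into V f v} \<in> E"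
        using f mem(1) that unfolding graph_auts_def by blast
      then show ?thesis using mem(2) that by simp
    qed
    then show "inv\<^bsub>BijGroup V\<^esub> f \<in> graph_auts V E"
      using fB restrict_inv_into_Bij[OF fB] by (simp add: inv_BijGroup graph_auts_def)
  next
    fix f g assume f: "f \<in> graph_auts V E" and g: "g \<in> graph_auts V E"
    then have B: "f \<in> Bij V" "g \<in> Bij V" by (simp_all add: graph_auts_def)
    have "g u \<in> V" if "u \<in> V" for u using Bij_imp_funcset[OF B(2)] that by auto
    then have "compose V f g \<in> graph_auts V E"
      using f g compose_Bij[OF B] by (simp add: graph_auts_def compose_def)
    then show "f \<otimes>\<^bsub>BijGroup V\<^esub> g \<in> graph_auts V E"
      using B by (simp add: BijGroup_def)
  qed
  then show ?thesis
    unfolding Aut_graph_def by (rule subgroup.subgroup_is_group) (rule group_BijGroup)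
qed

lemma group_dihedral_group:
  assumes "m > 0"
  shows "group (dihedral_group m)"
proof (rule groupI)
  fix x y assume "x \<in> carrier (dihedral_group m)" "y \<in> carrier (dihedral_group m)"
  then show "x \<otimes>\<^bsub>dihedral_group m\<^esub> y \<in> carrier (dihedral_group m)"
    using assms by (auto simp: dihedral_group_def)
next
  show "\<one>\<^bsub>dihedral_group m\<^esub> \<in> carrier (dihedral_group m)"
    using assms by (auto simp: dihedral_group_def)
next
  fix x y z :: "int \<times> bool"
  show "x \<otimes>\<^bsub>dihedral_group m\<^esub> y \<otimes>\<^bsub>dihedral_group m\<^esub> z =
    x \<otimes>\<^bsub>dihedral_group m\<^esub> (y \<otimes>\<^bsub>dihedral_group m\<^esub> z)"
    by (cases x; cases y; cases z) (auto simp: dihedral_group_def mod_simps algebra_simps)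
next
  fix x assume "x \<in> carrier (dihedral_group m)"
  then show "\<one>\<^bsub>dihedral_group m\<^esub> \<otimes>\<^bsub>dihedral_group m\<^esub> x = x"
    by (auto simp: dihedral_group_def)
next
  fix x assume x: "x \<in> carrier (dihedral_group m)"
  obtain a s where [simp]: "x = (a, s)" by (cases x)
  show "\<exists>y\<in>carrier (dihedral_group m). y \<otimes>\<^bsub>dihedral_group m\<^esub> x = \<one>\<^bsub>dihedral_group m\<^esub>"
    using x assms
    by (intro bexI[of _ "(if s then a else (- a) mod int m, s)"])
       (auto simp: dihedral_group_def mod_simps)
qed

lemma order_dihedral_group: "order (dihedral_group m) = 2 * m"
  by (simp add: order_def dihedral_group_def card_cartesian_product)

end

theory Submission
  imports Defs
begin

text \<open>
  Two distinct vertices of \<open>G\<^sub>n\<close> have three common neighbours exactly if they are the copies of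
  one Petersen vertex in cyclically consecutive layers. An automorphism therefore permutes the ten
  fibres by a Petersen automorphism \<open>p\<close> and acts on each of them by \<open>i \<mapsto> s x + e * i\<close>
  with \<open>e = \<plusminus>1\<close> independent of the fibre. On every edge of the Petersen graph twice the increment
  of \<open>s\<close> is determined modulo \<open>2 * n\<close> by the orientation signs of the edge and of its image,
  so \<open>p\<close> preserves, up to the factor \<open>e\<close>, the signed number of arcs along closed walks. This
  number is \<open>\<plusminus>3\<close> for the outer 5-cycle and \<open>\<plusminus>1\<close> for the other eleven 5-cycles, so \<open>p\<close>
  preserves the outer cycle, and an automorphism fixing a vertex of the outer fibres and
  the direction of the cycle is the identity.

  Conversely, \<open>G\<^sub>n\<close> is a bicirculant graph on two copies of the integers modulo \<open>5 * n\<close>, with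
  edges \<open>a\<^sub>m a\<^sub>m\<^sub>+\<^sub>1\<close>, \<open>a\<^sub>m a\<^sub>m\<^sub>+\<^sub>4\<close>, \<open>b\<^sub>m b\<^sub>m\<^sub>+\<^sub>2\<close>, \<open>b\<^sub>m b\<^sub>m\<^sub>+\<^sub>3\<close>, \<open>a\<^sub>m b\<^sub>m\<close>, \<open>a\<^sub>m b\<^sub>m\<^sub>-\<^sub>5\<close>. The rotations
  \<open>m \<mapsto> m + 1\<close> and the reflection \<open>a\<^sub>m \<mapsto> a\<^sub>-\<^sub>m\<close>, \<open>b\<^sub>m \<mapsto> b\<^sub>-\<^sub>5\<^sub>-\<^sub>m\<close> give the dihedral group of
  order \<open>10 * n\<close>.
\<close>

section \<open>Signed adjacency in the Petersen graph\<close>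

text \<open>The value is the layer offset of the non-horizontal edges leading from fibre
  \<open>x\<close> to fibre \<open>y\<close>. Being antisymmetric, it can be summed along closed
  walks.\<close>

definition arc_sign :: "nat \<Rightarrow> nat \<Rightarrow> int" where
  "arc_sign x y = (if (x, y) \<in> petersen_arcs then 1 else if (y, x) \<in> petersen_arcs then -1 else 0)"

text \<open>The row of vertex 1 is stated with \<open>Suc 0\<close>, the form to which the
  simplifier rewrites the natural number 1.\<close>

lemma arc_sign_nonzero_iff:
  "arc_sign 0 y \<noteq> 0 \<longleftrightarrow> y = 1 \<or> y = 4 \<or> y = 5"
  "arc_sign (Suc 0) y \<noteq> 0 \<longleftrightarrow> y = 0 \<or> y = 2 \<or> y = 6"
  "arc_sign 2 y \<noteq> 0 \<longleftrightarrow> y = 1 \<or> y = 3 \<or> y = 7"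
  "arc_sign 3 y \<noteq> 0 \<longleftrightarrow> y = 2 \<or> y = 4 \<or> y = 8"
  "arc_sign 4 y \<noteq> 0 \<longleftrightarrow> y = 0 \<or> y = 3 \<or> y = 9"
  "arc_sign 5 y \<noteq> 0 \<longleftrightarrow> y = 0 \<or> y = 7 \<or> y = 8"
  "arc_sign 6 y \<noteq> 0 \<longleftrightarrow> y = 1 \<or> y = 8 \<or> y = 9"
  "arc_sign 7 y \<noteq> 0 \<longleftrightarrow> y = 2 \<or> y = 5 \<or> y = 9"
  "arc_sign 8 y \<noteq> 0 \<longleftrightarrow> y = 3 \<or> y = 5 \<or> y = 6"
  "arc_sign 9 y \<noteq> 0 \<longleftrightarrow> y = 4 \<or> y = 6 \<or> y = 7"
  unfolding arc_sign_def petersen_arcs_def by auto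

lemma arc_sign_values [simp]:
  "arc_sign 0 (Suc 0) = 1" "arc_sign 0 4 = 1" "arc_sign 0 5 = 1" "arc_sign (Suc 0) 2 = 1" "arc_sign (Suc 0) 6 = 1"
  "arc_sign 2 3 = 1" "arc_sign 2 7 = 1" "arc_sign 3 4 = 1" "arc_sign 3 8 = 1" "arc_sign 4 9 = 1"
  "arc_sign 5 7 = 1" "arc_sign 5 8 = 1" "arc_sign 6 8 = 1" "arc_sign 6 9 = 1" "arc_sign 7 9 = 1"
  by (auto simp: arc_sign_def petersen_arcs_def)

lemma petersen_arcs_asym: "(x, y) \<in> petersen_arcs \<Longrightarrow> (y, x) \<notin> petersen_arcs"
  unfolding petersen_arcs_def by (elim insertE emptyE) simp_all

lemma arc_sign_minus: "arc_sign y x = - arc_sign x y"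
  using petersen_arcs_asym by (auto simp: arc_sign_def)

lemma arc_sign_values_rev [simp]:
  "arc_sign (Suc 0) 0 = -1" "arc_sign 4 0 = -1" "arc_sign 5 0 = -1" "arc_sign 2 (Suc 0) = -1" "arc_sign 6 (Suc 0) = -1"
  "arc_sign 3 2 = -1" "arc_sign 7 2 = -1" "arc_sign 4 3 = -1" "arc_sign 8 3 = -1" "arc_sign 9 4 = -1"
  "arc_sign 7 5 = -1" "arc_sign 8 5 = -1" "arc_sign 8 6 = -1" "arc_sign 9 6 = -1" "arc_sign 9 7 = -1"
  by (auto simp: arc_sign_def petersen_arcs_def)

lemma arc_sign_cases: "arc_sign x y = 0 \<or> arc_sign x y = 1 \<or> arc_sign x y = -1"
  by (simp add: arc_sign_def)

lemma arc_sign_bound: "arc_sign x y \<noteq> 0 \<Longrightarrow> x \<in> {0,1,2,3,4,5,6,7,8,9}"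
  unfolding arc_sign_def petersen_arcs_def by (auto split: if_splits)

definition petersen_nbrs :: "nat \<Rightarrow> nat set" where
  "petersen_nbrs x = {y. arc_sign x y \<noteq> 0}"

lemma petersen_nbrs_simps:
  "petersen_nbrs 0 = {1,4,5}" "petersen_nbrs (Suc 0) = {0,2,6}" "petersen_nbrs 2 = {1,3,7}"
  "petersen_nbrs 3 = {2,4,8}" "petersen_nbrs 4 = {0,3,9}" "petersen_nbrs 5 = {0,7,8}"
  "petersen_nbrs 6 = {1,8,9}" "petersen_nbrs 7 = {2,5,9}" "petersen_nbrs 8 = {3,5,6}"
  "petersen_nbrs 9 = {4,6,7}"
  unfolding petersen_nbrs_def arc_sign_nonzero_iff by auto

lemma petersen_nbrs_sym: "y \<in> petersen_nbrs x \<longleftrightarrow> x \<in> petersen_nbrs y"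
  using arc_sign_minus[of x y] by (auto simp: petersen_nbrs_def)

lemma petersen_nbrs_bound: "y \<in> petersen_nbrs x \<Longrightarrow> x \<in> {0,1,2,3,4,5,6,7,8,9}"
  unfolding petersen_nbrs_def using arc_sign_bound by blast

text \<open>Girth 5 excludes a 4-cycle \<open>x z y w\<close>. The proof enumerates all walks
  \<open>w x z y\<close>.\<close>

lemma petersen_common_nbr_unique:
  assumes "z \<in> petersen_nbrs x" "z \<in> petersen_nbrs y" "w \<in> petersen_nbrs x" "w \<in> petersen_nbrs y" "x \<noteq> y"
  shows "z = w"
proof -
  have "\<forall>x\<in>{0,1,2,3,4,5,6,7,8,9}. \<forall>z\<in>petersen_nbrs x. \<forall>y\<in>petersen_nbrs z.
      \<forall>w\<in>petersen_nbrs x. y \<in> petersen_nbrs w \<longrightarrow> x = y \<or> z = w"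
    by (simp add: petersen_nbrs_simps)
  moreover have "x \<in> {0,1,2,3,4,5,6,7,8,9}" using assms(1) by (rule petersen_nbrs_bound)
  ultimately show ?thesis using assms petersen_nbrs_sym by blast
qed

text \<open>By girth 5 every closed walk of length 5 is a 5-cycle, and the proof runs through all of
  them. Only the outer cycle has four of its five arcs pointing the same way round with a single one
  against them.\<close>

lemma petersen_five_cycle_sign_sum:
  assumes "b \<in> petersen_nbrs a" "c \<in> petersen_nbrs b" "d \<in> petersen_nbrs c"
    "e \<in> petersen_nbrs d" "a \<in> petersen_nbrs e"
  shows "\<bar>arc_sign a b + arc_sign b c + arc_sign c d + arc_sign d e + arc_sign e a\<bar> = 1 \<or>
    {a, b, c, d, e} \<subseteq> {..4}"
proof -
  have "\<forall>a\<in>{0,1,2,3,4,5,6,7,8,9}. \<forall>b\<in>petersen_nbrs a. \<forall>c\<in>petersen_nbrs b. \<forall>d\<in>petersen_nbrs c.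
    \<forall>e\<in>petersen_nbrs d. a \<in> petersen_nbrs e \<longrightarrow>
    \<bar>arc_sign a b + arc_sign b c + arc_sign c d + arc_sign d e + arc_sign e a\<bar> = 1 \<or>
    {a, b, c, d, e} \<subseteq> {..4}"
    by (simp add: petersen_nbrs_simps)
  moreover have "a \<in> {0,1,2,3,4,5,6,7,8,9}" using assms(1) by (rule petersen_nbrs_bound)
  ultimately show ?thesis using assms by blast
qed

lemma petersen_nbrs_three:
  assumes "x \<le> 9"
  obtains y1 y2 y3 where "petersen_nbrs x = {y1, y2, y3}" "y1 \<noteq> y2" "y1 \<noteq> y3" "y2 \<noteq> y3"
proof -
  have "x \<in> {0,1,2,3,4,5,6,7,8,9}" using assms by auto
  then have "card (petersen_nbrs x) = 3"
    by (elim insertE emptyE) (simp_all add: petersen_nbrs_simps)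
  then show thesis using that by (auto simp: card_3_iff)
qed

section \<open>Vertices with integer layers\<close>

text \<open>The layers \<open>1, \<dots>, n\<close> are indexed by all integers, read modulo \<open>n\<close>.\<close>

definition gvert :: "nat \<Rightarrow> int \<Rightarrow> nat \<Rightarrow> nat \<times> nat" where
  "gvert n i x = (nat ((i - 1) mod int n) + 1, x)"

context
  fixes n :: nat
  assumes n3: "n \<ge> 3"
begin

lemma gvert_eq_iff: "gvert n i x = gvert n j y \<longleftrightarrow> x = y \<and> int n dvd i - j"
proof -
  have "nat ((i - 1) mod int n) = nat ((j - 1) mod int n) \<longleftrightarrow> (i - 1) mod int n = (j - 1) mod int n"
    using n3 by (subst eq_nat_nat_iff) auto
  also have "\<dots> \<longleftrightarrow> int n dvd i - j"
    by (simp add: mod_eq_dvd_iff)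
  finally show ?thesis by (auto simp: gvert_def)
qed

lemma gvert_in_iff: "gvert n i x \<in> G_verts n \<longleftrightarrow> x \<le> 9"
proof -
  have "nat ((i - 1) mod int n) < n"
    using n3 by (simp add: nat_less_iff)
  then show ?thesis by (auto simp: gvert_def G_verts_def)
qed

lemma gvert_of_nat: "i \<in> {1..n} \<Longrightarrow> gvert n (int i) x = (i, x)"
  by (auto simp: gvert_def nat_diff_distrib)

lemma gvert_cases:
  assumes "v \<in> G_verts n"
  obtains i x where "v = gvert n i x" "x \<le> 9"
  using assms gvert_of_nat by (auto simp: G_verts_def) (metis atLeastAtMost_iff One_nat_def)

lemma gvert_cyc: "i \<in> {1..n} \<Longrightarrow> (cyc n i, x) = gvert n (int i + 1) x"
  by (auto simp: gvert_def cyc_def)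

text \<open>Each horizontal edge is listed in the direction of its arc, so both kinds of edges come
  from arcs and differ only in the offset \<open>k\<close>.\<close>

lemma G_edges_conv_gvert:
  "G_edges n = {{gvert n i x, gvert n (i + k) y} | i k x y. (x, y) \<in> petersen_arcs \<and> k \<in> {0, 1}}"
  (is "_ = ?R")
proof (intro equalityI subsetI)
  fix e assume "e \<in> G_edges n"
  then consider
      (same) i x y where "e = {(i, x), (i, y)}" "i \<in> {1..n}" "{x, y} \<in> petersen_edges"
    | (next_copy) i x y where "e = {(i, x), (cyc n i, y)}" "i \<in> {1..n}" "(x, y) \<in> petersen_arcs"
    unfolding G_edges_def by blast
  then show "e \<in> ?R"
  proof cases
    case same
    from same(3) obtain a b where ab: "{x, y} = {a, b}" "(a, b) \<in> petersen_arcs"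
      unfolding petersen_edges_def by blast
    have "e = {gvert n (int i) a, gvert n (int i + 0) b}"
      using same(1,2) ab(1) by (auto simp: gvert_of_nat doubleton_eq_iff)
    then show ?thesis using ab(2) by blast
  next
    case next_copy
    then have "e = {gvert n (int i) x, gvert n (int i + 1) y}" by (simp add: gvert_of_nat gvert_cyc)
    then show ?thesis using next_copy(3) by blast
  qed
next
  fix e assume "e \<in> ?R"
  then obtain i k x y where e: "e = {gvert n i x, gvert n (i + k) y}" and arc: "(x, y) \<in> petersen_arcs"
    and k: "k \<in> {0, 1}" by blast
  define j where "j = nat ((i - 1) mod int n) + 1"
  have j: "j \<in> {1..n}" using gvert_in_iff[of i 0] by (simp add: j_def gvert_def G_verts_def)
  have "gvert n i x = (j, x)" for x by (simp add: gvert_def j_def)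
  moreover have ij: "gvert n i 0 = gvert n (int j) 0" using gvert_of_nat[OF j] calculation by simp
  moreover have "gvert n (i + 1) y = (cyc n j, y)"
    using ij by (simp add: gvert_cyc[OF j] gvert_eq_iff)
  ultimately show "e \<in> G_edges n"
    using k e arc j unfolding G_edges_def petersen_edges_def by auto
qed

text \<open>Over one Petersen edge the offsets 0 and \<open>arc_sign x y\<close> link the two fibres
  into a single cycle of length \<open>2 * n\<close>. The sign lets one formula serve both
  directions of the arc.\<close>

lemma gvert_adjacent_iff:
  "{gvert n i x, gvert n j y} \<in> G_edges n \<longleftrightarrow>
    y \<in> petersen_nbrs x \<and> (int n dvd j - i \<or> int n dvd j - i - arc_sign x y)"
proof -
  have arcs: "{gvert n i x, gvert n j y} \<in> G_edges n \<longleftrightarrow>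
     (x, y) \<in> petersen_arcs \<and> (int n dvd j - i \<or> int n dvd j - i - 1) \<or>
     (y, x) \<in> petersen_arcs \<and> (int n dvd i - j \<or> int n dvd i - j - 1)" (is "?L \<longleftrightarrow> ?R")
  proof
    assume ?L
    then obtain i' k x' y' where e: "{gvert n i x, gvert n j y} = {gvert n i' x', gvert n (i' + k) y'}"
      and arc: "(x', y') \<in> petersen_arcs" and k: "k \<in> {0, 1}"
      unfolding G_edges_conv_gvert by blast
    from e consider "x = x'" "y = y'" "int n dvd i - i'" "int n dvd j - (i' + k)"
      | "x = y'" "y = x'" "int n dvd j - i'" "int n dvd i - (i' + k)"
      by (auto simp: doubleton_eq_iff gvert_eq_iff)
    then show ?R
    proof cases
      case 1
      have "int n dvd j - i - k" using dvd_diff[OF 1(4,3)] by (simp add: algebra_simps)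
      then show ?thesis using 1 arc k by auto
    next
      case 2
      have "int n dvd i - j - k" using dvd_diff[OF 2(4,3)] by (simp add: algebra_simps)
      then show ?thesis using 2 arc k by auto
    qed
  next
    have *: "{gvert n i x, gvert n j y} \<in> G_edges n"
      if "(x, y) \<in> petersen_arcs" "k \<in> {0, 1}" "int n dvd j - i - k" for i j x y k
    proof -
      have "gvert n j y = gvert n (i + k) y" using that(3) by (simp add: gvert_eq_iff algebra_simps)
      with that(1,2) show ?thesis
        unfolding G_edges_conv_gvert by (intro CollectI exI[of _ i] exI[of _ k] exI[of _ x] exI[of _ y]) simp
    qed
    assume ?R
    then show ?L
      using *[of x y 0 j i] *[of x y 1 j i] *[of y x 0 i j] *[of y x 1 i j] by (auto simp: insert_commute)
  qed
  have "int n dvd i - j \<longleftrightarrow> int n dvd j - i"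
    "int n dvd i - j - 1 \<longleftrightarrow> int n dvd j - i + 1"
    using dvd_minus_iff[of "int n" "j - i"] dvd_minus_iff[of "int n" "j - i + 1"] by (auto simp: algebra_simps)
  then show ?thesis
    unfolding arcs petersen_nbrs_def arc_sign_def using petersen_arcs_asym[of x y] by auto
qed

end

section \<open>The bicirculant description\<close>

text \<open>\<open>bvert n False m\<close> and \<open>bvert n True m\<close> are \<open>a\<^sub>m\<close> and \<open>b\<^sub>m\<close>. Adding \<open>5\<close> to \<open>m\<close> lowers the layer
  by one: with this sign all arcs fit the steps listed in \<open>bicirculant_steps\<close>.\<close>

definition bvert :: "nat \<Rightarrow> bool \<Rightarrow> int \<Rightarrow> nat \<times> nat" where
  "bvert n b m = gvert n (- (m div 5)) (nat (m mod 5) + (if b then 5 else 0))"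

definition bicirculant_steps :: "(bool \<times> bool \<times> int) set" where
  "bicirculant_steps = {(False, False, 1), (False, False, 4), (True, True, 2), (True, True, 3),
     (False, True, 0), (False, True, -5)}"

lemma int_residue5_cases:
  fixes m :: int
  obtains q r where "m = 5 * q + r" "r \<in> {0,1,2,3,4}"
proof
  show "m = 5 * (m div 5) + m mod 5" by simp
  show "m mod 5 \<in> {0,1,2,3,4}" by auto
qed

text \<open>The extra 5 in the reflection of the \<open>b\<close>-vertices makes it exchange the two
  spoke steps 0 and -5.\<close>

definition dact :: "int \<times> bool \<Rightarrow> bool \<Rightarrow> int \<Rightarrow> int" where
  "dact g b m = (if snd g then fst g - m - (if b then 5 else 0) else fst g + m)"

text \<open>The index \<open>int (x mod 5) - 5 * int i\<close> is one that \<open>bvert\<close>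
  sends back to \<open>(i, x)\<close>. The restriction to \<open>G_verts n\<close> is what
  \<open>Bij\<close> demands of its members.\<close>

definition dmap :: "nat \<Rightarrow> int \<times> bool \<Rightarrow> nat \<times> nat \<Rightarrow> nat \<times> nat" where
  "dmap n g = (\<lambda>(i, x)\<in>G_verts n. bvert n (x \<ge> 5) (dact g (x \<ge> 5) (int (x mod 5) - 5 * int i)))"

context
  fixes n :: nat
  assumes n3: "n \<ge> 3"
begin

lemma gvert_eq_bvert:
  assumes "x \<le> 9"
  shows "gvert n i x = bvert n (x \<ge> 5) (int (x mod 5) - 5 * i)"
proof -
  have "int (x mod 5) - 5 * i = int (x mod 5) + 5 * (- i)" by simp
  then have "(int (x mod 5) - 5 * i) div 5 = - i" "(int (x mod 5) - 5 * i) mod 5 = int (x mod 5)"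
    by (simp_all only: div_mult_self2 mod_mult_self2) simp_all
  moreover have "x mod 5 + (if x \<ge> 5 then 5 else 0) = x"
    using assms by (auto simp: mod_if)
  ultimately show ?thesis by (simp add: bvert_def)
qed

text \<open>A class modulo \<open>5 * n\<close> amounts to a residue modulo 5, the place within a
  layer, and a quotient by 5 taken modulo \<open>n\<close>, the layer.\<close>

lemma bvert_eq_iff: "bvert n b m = bvert n b' m' \<longleftrightarrow> b = b' \<and> int (5 * n) dvd m - m'"
proof -
  have lt: "nat (k mod 5) < 5" for k :: int by (simp add: nat_less_iff)
  have x: "nat (m mod 5) + (if b then 5 else 0) = nat (m' mod 5) + (if b' then 5 else 0) \<longleftrightarrow>
      b = b' \<and> m mod 5 = m' mod 5"
    using lt[of m] lt[of m'] by (auto simp: nat_eq_iff)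
  have "int n dvd - (m div 5) - - (m' div 5) \<longleftrightarrow> m div 5 mod int n = m' div 5 mod int n"
    by (simp add: mod_eq_dvd_iff dvd_diff_commute)
  moreover have "m mod (5 * int n) = m' mod (5 * int n) \<longleftrightarrow>
      m mod 5 = m' mod 5 \<and> m div 5 mod int n = m' div 5 mod int n"
  proof
    assume a: "m mod (5 * int n) = m' mod (5 * int n)"
    then have "m mod 5 = m' mod 5" by (metis mod_mod_cancel dvd_triv_left)
    with a show "m mod 5 = m' mod 5 \<and> m div 5 mod int n = m' div 5 mod int n"
      using zmod_zmult2_eq[of "int n" m 5] zmod_zmult2_eq[of "int n" m' 5] by simp
  qed (simp add: zmod_zmult2_eq)
  ultimately show ?thesis
    unfolding bvert_def gvert_eq_iff[OF n3] x by (auto simp: mod_eq_dvd_iff)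
qed

lemma bvert_in: "bvert n b m \<in> G_verts n"
proof -
  have "nat (m mod 5) < 5" by (simp add: nat_less_iff)
  then show ?thesis unfolding bvert_def gvert_in_iff[OF n3] by simp
qed

lemma bvert_cases:
  assumes "v \<in> G_verts n"
  obtains b m where "v = bvert n b m"
proof -
  obtain i x where "v = gvert n i x" "x \<le> 9" using gvert_cases[OF n3 assms] .
  then show thesis using that gvert_eq_bvert by simp
qed

lemma bvert_step_adjacent:
  assumes "(b, b', d) \<in> bicirculant_steps"
  shows "{bvert n b m, bvert n b' (m + d)} \<in> G_edges n"
proof -
  \<comment> \<open>The quotient \<open>q\<close> shifts both layers equally, so five residues and
    six steps leave a finite check.\<close>
  obtain q r where m: "m = 5 * q + r" and r: "r \<in> {0,1,2,3,4}" by (rule int_residue5_cases)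
  have div5: "(5 * q + c) div 5 = q + c div 5" "(5 * q + c) mod 5 = c mod 5" for c
    by simp_all
  show ?thesis
    using r assms unfolding bicirculant_steps_def m add.assoc bvert_def gvert_adjacent_iff[OF n3] div5
    by (elim insertE emptyE) (simp_all add: petersen_nbrs_simps)
qed

text \<open>Moving to the next layer lowers the index by 5. It turns the arc steps 1, 4, 2, 3 into
  -4, -1, -3, -2, which are listed steps read backwards, and the spoke step 0 into -5.\<close>

lemma G_edges_conv_bvert:
  "G_edges n = {{bvert n b m, bvert n b' (m + d)} | b b' m d. (b, b', d) \<in> bicirculant_steps}"
  (is "_ = ?R")
proof (intro equalityI subsetI)
  fix e assume "e \<in> G_edges n"
  then obtain i k x y where e: "e = {gvert n i x, gvert n (i + k) y}" and arc: "(x, y) \<in> petersen_arcs"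
    and k: "k \<in> {0, 1}" unfolding G_edges_conv_gvert[OF n3] by blast
  have xy: "x \<le> 9" "y \<le> 9" using petersen_arcs_bounds[OF arc] by auto
  define d where "d = (int (y mod 5) - 5 * (i + k)) - (int (x mod 5) - 5 * i)"
  have d: "d = int (y mod 5) - int (x mod 5) - 5 * k" by (simp add: d_def)
  have e1: "e = {bvert n (x \<ge> 5) (int (x mod 5) - 5 * i), bvert n (y \<ge> 5) (int (x mod 5) - 5 * i + d)}"
    unfolding e gvert_eq_bvert[OF xy(1)] gvert_eq_bvert[OF xy(2)] d_def by (simp add: algebra_simps)
  have e2: "e = {bvert n (y \<ge> 5) (int (y mod 5) - 5 * (i + k)), bvert n (x \<ge> 5) (int (y mod 5) - 5 * (i + k) + (- d))}"
    unfolding e gvert_eq_bvert[OF xy(1)] gvert_eq_bvert[OF xy(2)] d_def by (simp add: insert_commute)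
  have "(x \<ge> 5, y \<ge> 5, d) \<in> bicirculant_steps \<or> (y \<ge> 5, x \<ge> 5, - d) \<in> bicirculant_steps"
    using arc k unfolding petersen_arcs_def d bicirculant_steps_def
    by (elim insertE emptyE; simp)
  then show "e \<in> ?R" using e1 e2 by blast
next
  fix e assume "e \<in> ?R"
  then show "e \<in> G_edges n" using bvert_step_adjacent by blast
qed

text \<open>\<open>dact g b\<close> maps congruent indices modulo \<open>5 * n\<close> to congruent
  ones, so the result does not depend on the representative index used in
  \<open>dmap\<close>.\<close>

lemma dmap_bvert: "dmap n g (bvert n b m) = bvert n b (dact g b m)"
proof -
  obtain i x where ix: "bvert n b m = (i, x)" by (cases "bvert n b m")
  then have mem: "(i, x) \<in> G_verts n" using bvert_in[of b m] by simp
  then have "(i, x) = bvert n (x \<ge> 5) (int (x mod 5) - 5 * int i)"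
    using gvert_eq_bvert[of x "int i"] gvert_of_nat[OF n3, of i x] by (simp add: G_verts_def)
  with ix have b: "b = (x \<ge> 5)" and "int (5 * n) dvd m - (int (x mod 5) - 5 * int i)"
    using bvert_eq_iff by metis+
  then have "int (5 * n) dvd dact g b (int (x mod 5) - 5 * int i) - dact g b m"
    using dvd_minus_iff[of "int (5 * n)" "m - (int (x mod 5) - 5 * int i)"]
    by (auto simp: dact_def algebra_simps)
  then show ?thesis using ix mem b by (simp add: dmap_def bvert_eq_iff)
qed

lemma dact_dact: "dact g b (dact h b m) = dact (if snd g then fst g - fst h else fst g + fst h, snd g \<noteq> snd h) b m"
  by (auto simp: dact_def)

lemma dmap_mult:
  assumes "v \<in> G_verts n"
  shows "dmap n (g \<otimes>\<^bsub>dihedral_group (5 * n)\<^esub> h) v = dmap n g (dmap n h v)"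
proof -
  obtain b m where v: "v = bvert n b m" using assms by (rule bvert_cases)
  obtain a s c t where gh: "g = (a, s)" "h = (c, t)" by (cases g; cases h) auto
  have dvd: "int (5 * n) dvd (k mod int (5 * n)) - k" for k
    by (metis mod_eq_dvd_iff mod_mod_trivial)
  have "int (5 * n) dvd dact (k mod int (5 * n), r) b m - dact (k, r) b m" for k r
    using dvd[of k] by (simp add: dact_def)
  then show ?thesis
    unfolding v dmap_bvert dact_dact gh by (simp add: bvert_eq_iff dihedral_group_def)
qed

text \<open>Rotations keep every step. The reflection runs an edge inside one orbit backwards with
  the same step, and replaces a spoke step \<open>d\<close> by \<open>-5 - d\<close>.\<close>

lemma dmap_edge:
  assumes "u \<in> G_verts n" "v \<in> G_verts n" "{u, v} \<in> G_edges n"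
  shows "{dmap n g u, dmap n g v} \<in> G_edges n"
proof -
  obtain b b' m d where e: "{u, v} = {bvert n b m, bvert n b' (m + d)}" and step: "(b, b', d) \<in> bicirculant_steps"
    using assms(3) unfolding G_edges_conv_bvert by blast
  have "{bvert n b (dact g b m), bvert n b' (dact g b' (m + d))} \<in> G_edges n"
  proof (cases "snd g")
    case False
    then show ?thesis using bvert_step_adjacent[OF step, of "dact g b m"] by (simp add: dact_def add.assoc)
  next
    case True
    show ?thesis
    proof (cases "b = b'")
      case True
      have "dact g b m = dact g b (m + d) + d" using \<open>snd g\<close> by (simp add: dact_def)
      then show ?thesis using bvert_step_adjacent[OF step, of "dact g b (m + d)"] True
        by (simp add: insert_commute)
    next
      case False
      then have b: "\<not> b" "b'" and step': "(b, b', -5 - d) \<in> bicirculant_steps"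
        using step by (auto simp: bicirculant_steps_def)
      have "dact g b' (m + d) = dact g b m + (-5 - d)" using \<open>snd g\<close> b by (simp add: dact_def)
      then show ?thesis using bvert_step_adjacent[OF step', of "dact g b m"] by simp
    qed
  qed
  then have "{dmap n g (bvert n b m), dmap n g (bvert n b' (m + d))} \<in> G_edges n"
    by (simp add: dmap_bvert)
  moreover have "{dmap n g u, dmap n g v} = dmap n g ` {u, v}" by simp
  ultimately show ?thesis unfolding e by simp
qed

lemma dmap_one: "v \<in> G_verts n \<Longrightarrow> dmap n (0, False) v = v"
  by (erule bvert_cases) (simp add: dmap_bvert dact_def)

lemma dmap_in_verts: "v \<in> G_verts n \<Longrightarrow> dmap n g v \<in> G_verts n"
  by (erule bvert_cases) (simp add: dmap_bvert bvert_in)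

text \<open>The inverse group element provides the inverse map. Applying \<open>dmap_edge\<close> to
  it gives the converse implication for edges.\<close>

lemma dmap_in_graph_auts:
  assumes "g \<in> carrier (dihedral_group (5 * n))"
  shows "dmap n g \<in> graph_auts (G_verts n) (G_edges n)"
proof -
  interpret D: group "dihedral_group (5 * n)" using n3 by (intro group_dihedral_group) simp
  define h where "h = inv\<^bsub>dihedral_group (5 * n)\<^esub> g"
  have one: "\<one>\<^bsub>dihedral_group (5 * n)\<^esub> = (0, False)" by (simp add: dihedral_group_def)
  have hg: "dmap n h (dmap n g v) = v" if "v \<in> G_verts n" for v
    using dmap_mult[OF that, of h g] D.l_inv[OF assms] dmap_one[OF that] one by (simp add: h_def)
  have gh: "dmap n g (dmap n h v) = v" if "v \<in> G_verts n" for v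
    using dmap_mult[OF that, of g h] D.r_inv[OF assms] dmap_one[OF that] one by (simp add: h_def)
  have "bij_betw (dmap n g) (G_verts n) (G_verts n)"
    by (rule bij_betw_byWitness[of _ "dmap n h"]) (simp_all add: hg gh image_subset_iff dmap_in_verts)
  moreover have "dmap n g \<in> extensional (G_verts n)" by (simp add: dmap_def)
  moreover have "{dmap n g u, dmap n g v} \<in> G_edges n \<longleftrightarrow> {u, v} \<in> G_edges n"
    if "u \<in> G_verts n" "v \<in> G_verts n" for u v
    using dmap_edge[OF that, of g] dmap_edge[OF dmap_in_verts[OF that(1)] dmap_in_verts[OF that(2)], of g g h]
      hg that by auto
  ultimately show ?thesis by (simp add: graph_auts_def Bij_def)
qed

lemma dmap_hom: "dmap n \<in> hom (dihedral_group (5 * n)) (Aut_graph (G_verts n) (G_edges n))"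
proof (rule homI)
  fix g assume "g \<in> carrier (dihedral_group (5 * n))"
  then show "dmap n g \<in> carrier (Aut_graph (G_verts n) (G_edges n))"
    by (simp add: Aut_graph_def dmap_in_graph_auts)
next
  fix g h assume gh: "g \<in> carrier (dihedral_group (5 * n))" "h \<in> carrier (dihedral_group (5 * n))"
  have "dmap n g \<in> Bij (G_verts n)" "dmap n h \<in> Bij (G_verts n)"
    using gh[THEN dmap_in_graph_auts] by (auto simp: graph_auts_def)
  moreover have "dmap n (g \<otimes>\<^bsub>dihedral_group (5 * n)\<^esub> h) = compose (G_verts n) (dmap n g) (dmap n h)"
    by (rule extensionalityI[of _ "G_verts n"]) (simp_all add: dmap_mult compose_eq, simp add: dmap_def)
  ultimately show "dmap n (g \<otimes>\<^bsub>dihedral_group (5 * n)\<^esub> h) =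
      dmap n g \<otimes>\<^bsub>Aut_graph (G_verts n) (G_edges n)\<^esub> dmap n h"
    by (simp add: Aut_graph_def BijGroup_def)
qed

text \<open>The image of index 0 determines the translation part. The image of index 1 then
  determines the reflection bit, since otherwise \<open>5 * n\<close> would divide 2.\<close>

lemma dmap_inj: "inj_on (dmap n) (carrier (dihedral_group (5 * n)))"
proof (rule inj_onI)
  fix g h assume g: "g \<in> carrier (dihedral_group (5 * n))" and h: "h \<in> carrier (dihedral_group (5 * n))"
    and eq: "dmap n g = dmap n h"
  have dvd: "int (5 * n) dvd dact g False m - dact h False m" for m
    using arg_cong[OF eq, of "\<lambda>f. f (bvert n False m)"] by (simp add: dmap_bvert bvert_eq_iff)
  have "int (5 * n) dvd fst g - fst h" using dvd[of 0] by (simp add: dact_def split: if_splits)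
  moreover have "fst g \<in> {0..<int (5 * n)}" "fst h \<in> {0..<int (5 * n)}"
    using g h by (auto simp: dihedral_group_def)
  ultimately have fst: "fst g = fst h"
    by (metis atLeastLessThan_iff mod_eq_dvd_iff mod_pos_pos_trivial)
  have "\<not> int (5 * n) dvd 2" "\<not> int (5 * n) dvd -2"
    using n3 zdvd_imp_le[of "int (5 * n)" 2] by (auto simp del: of_nat_mult)
  then have "snd g = snd h" using dvd[of 1] fst by (auto simp: dact_def split: if_splits)
  with fst show "g = h" by (simp add: prod_eq_iff)
qed

end

section \<open>Rigidity of the fibres\<close>

text \<open>Explicit witnesses let an automorphism carry the property over without any
  counting.\<close>

definition three_common_nbrs :: "'a set \<Rightarrow> 'a set set \<Rightarrow> 'a \<Rightarrow> 'a \<Rightarrow> bool" where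
  "three_common_nbrs V E u v \<longleftrightarrow> u \<noteq> v \<and> (\<exists>w1\<in>V. \<exists>w2\<in>V. \<exists>w3\<in>V. w1 \<noteq> w2 \<and> w1 \<noteq> w3 \<and> w2 \<noteq> w3 \<and>
     (\<forall>w\<in>{w1, w2, w3}. {u, w} \<in> E \<and> {v, w} \<in> E))"

lemma three_common_nbrs_aut:
  assumes f: "f \<in> graph_auts V E" and uv: "u \<in> V" "v \<in> V" and c: "three_common_nbrs V E u v"
  shows "three_common_nbrs V E (f u) (f v)"
proof -
  have inj: "f a = f b \<longleftrightarrow> a = b" if "a \<in> V" "b \<in> V" for a b
    using f that by (auto simp: graph_auts_def Bij_def bij_betw_def inj_on_def)
  have mem: "f a \<in> V" if "a \<in> V" for a
    using f that by (auto simp: graph_auts_def Bij_def bij_betw_def)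
  have edge: "{f a, f b} \<in> E \<longleftrightarrow> {a, b} \<in> E" if "a \<in> V" "b \<in> V" for a b
    using f that by (auto simp: graph_auts_def)
  obtain w1 w2 w3 where w: "w1 \<in> V" "w2 \<in> V" "w3 \<in> V" "w1 \<noteq> w2" "w1 \<noteq> w3" "w2 \<noteq> w3"
    "\<forall>w\<in>{w1, w2, w3}. {u, w} \<in> E \<and> {v, w} \<in> E" and "u \<noteq> v"
    using c unfolding three_common_nbrs_def by blast
  then show ?thesis
    unfolding three_common_nbrs_def using uv inj mem edge
    by (intro conjI bexI[of _ "f w1"] bexI[of _ "f w2"] bexI[of _ "f w3"]) auto
qed

context
  fixes n :: nat
  assumes n3: "n \<ge> 3"
begin

lemma three_common_nbrs_gvert_Suc:
  assumes "x \<le> 9"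
  shows "three_common_nbrs (G_verts n) (G_edges n) (gvert n i x) (gvert n (i + 1) x)"
proof -
  obtain y1 y2 y3 where y: "petersen_nbrs x = {y1, y2, y3}" "y1 \<noteq> y2" "y1 \<noteq> y3" "y2 \<noteq> y3"
    using assms by (rule petersen_nbrs_three)
  \<comment> \<open>In each neighbouring fibre exactly one layer is adjacent to both vertices: the
    upper one if the arc leaves \<open>x\<close>, the lower one if it enters
    \<open>x\<close>.\<close>
  define w where "w y = gvert n (if arc_sign x y = 1 then i + 1 else i) y" for y
  have "{gvert n i x, w y} \<in> G_edges n \<and> {gvert n (i + 1) x, w y} \<in> G_edges n \<and> w y \<in> G_verts n"
    if "y \<in> petersen_nbrs x" for y
  proof -
    have "arc_sign x y = 1 \<or> arc_sign x y = -1"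
      using that arc_sign_cases[of x y] by (auto simp: petersen_nbrs_def)
    moreover have "y \<le> 9" using petersen_nbrs_bound[of x y] that petersen_nbrs_sym by auto
    ultimately show ?thesis
      using that by (auto simp: w_def gvert_adjacent_iff[OF n3] gvert_in_iff[OF n3])
  qed
  moreover have "w y \<noteq> w z" if "y \<noteq> z" for y z
    using that by (simp add: w_def gvert_eq_iff[OF n3])
  moreover have "gvert n i x \<noteq> gvert n (i + 1) x"
    using n3 by (auto simp: gvert_eq_iff[OF n3])
  ultimately show ?thesis
    using y unfolding three_common_nbrs_def
    by (intro conjI bexI[of _ "w y1"] bexI[of _ "w y2"] bexI[of _ "w y3"]) auto
qed

lemma three_common_nbrs_gvertD:
  assumes c: "three_common_nbrs (G_verts n) (G_edges n) (gvert n i x) (gvert n j y)"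
  shows "x = y \<and> (int n dvd j - i - 1 \<or> int n dvd j - i + 1)"
proof -
  obtain w1 w2 w3 where w: "w1 \<in> G_verts n" "w2 \<in> G_verts n" "w3 \<in> G_verts n"
    and dist: "w1 \<noteq> w2" "w1 \<noteq> w3" "w2 \<noteq> w3"
    and adj: "\<And>w. w \<in> {w1, w2, w3} \<Longrightarrow> {gvert n i x, w} \<in> G_edges n \<and> {gvert n j y, w} \<in> G_edges n"
    and ne: "gvert n i x \<noteq> gvert n j y"
    using c unfolding three_common_nbrs_def by blast
  obtain l1 z1 where w1: "w1 = gvert n l1 z1" using gvert_cases[OF n3 w(1)] by metis
  obtain l2 z2 where w2: "w2 = gvert n l2 z2" using gvert_cases[OF n3 w(2)] by metis
  obtain l3 z3 where w3: "w3 = gvert n l3 z3" using gvert_cases[OF n3 w(3)] by metis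
  have a1: "z1 \<in> petersen_nbrs x" "z1 \<in> petersen_nbrs y"
      "int n dvd l1 - i \<or> int n dvd l1 - i - arc_sign x z1" "int n dvd l1 - j \<or> int n dvd l1 - j - arc_sign y z1"
    using adj[of w1] by (auto simp: w1 gvert_adjacent_iff[OF n3])
  have a2: "z2 \<in> petersen_nbrs x" "z2 \<in> petersen_nbrs y"
      "int n dvd l2 - i \<or> int n dvd l2 - i - arc_sign x z2"
    using adj[of w2] by (auto simp: w2 gvert_adjacent_iff[OF n3])
  have a3: "z3 \<in> petersen_nbrs x" "z3 \<in> petersen_nbrs y"
      "int n dvd l3 - i \<or> int n dvd l3 - i - arc_sign x z3"
    using adj[of w3] by (auto simp: w3 gvert_adjacent_iff[OF n3])
  have cong: "int n dvd a - b" if "int n dvd a - c" "int n dvd b - c" for a b c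
    using dvd_diff[OF that] by simp
  \<comment> \<open>Otherwise all three common neighbours lie over the unique common Petersen
    neighbour, but a vertex has only two neighbours in that fibre.\<close>
  have xy: "x = y"
  proof (rule ccontr)
    assume "x \<noteq> y"
    then have z: "z2 = z1" "z3 = z1"
      using petersen_common_nbr_unique a1(1,2) a2(1,2) a3(1,2) by blast+
    have "\<not> int n dvd l1 - l2" "\<not> int n dvd l1 - l3" "\<not> int n dvd l2 - l3"
      using dist z by (auto simp: w1 w2 w3 gvert_eq_iff[OF n3])
    moreover have "int n dvd l1 - (i + c) \<or> int n dvd l1 - i"
      "int n dvd l2 - (i + c) \<or> int n dvd l2 - i" "int n dvd l3 - (i + c) \<or> int n dvd l3 - i"
      if "c = arc_sign x z1" for c
      using a1(3) a2(3) a3(3) z that by (auto simp: algebra_simps)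
    ultimately show False using cong by blast
  qed
  \<comment> \<open>As the two layers differ, the common neighbour \<open>w1\<close> is at offset 0
    from one of them and at offset \<open>arc_sign x z1\<close> from the other.\<close>
  have "\<not> int n dvd i - j" using ne xy by (simp add: gvert_eq_iff[OF n3])
  then have "\<not> (int n dvd l1 - i \<and> int n dvd l1 - j)"
    "\<not> (int n dvd l1 - i - arc_sign x z1 \<and> int n dvd l1 - j - arc_sign x z1)"
    using dvd_diff[of "int n" "l1 - j" "l1 - i"]
      dvd_diff[of "int n" "l1 - j - arc_sign x z1" "l1 - i - arc_sign x z1"] by auto
  with a1(3,4) xy consider "int n dvd l1 - i" "int n dvd l1 - j - arc_sign x z1"
    | "int n dvd l1 - i - arc_sign x z1" "int n dvd l1 - j" by blast
  then have "int n dvd j - i + arc_sign x z1 \<or> int n dvd j - i - arc_sign x z1"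
  proof cases
    case 1
    then show ?thesis using dvd_diff[OF 1] by (simp add: algebra_simps)
  next
    case 2
    then show ?thesis using dvd_diff[OF 2] by (simp add: algebra_simps)
  qed
  then show ?thesis
    using xy a1(1) arc_sign_cases[of x z1] by (auto simp: petersen_nbrs_def)
qed

end

section \<open>The structure of automorphisms\<close>

context
  fixes n :: nat and f :: "nat \<times> nat \<Rightarrow> nat \<times> nat"
  assumes n3: "n \<ge> 3" and f: "f \<in> graph_auts (G_verts n) (G_edges n)"
begin

lemma aut_eq_iff:
  assumes "x \<le> 9" "y \<le> 9"
  shows "f (gvert n i x) = f (gvert n j y) \<longleftrightarrow> x = y \<and> int n dvd i - j"
proof -
  have "inj_on f (G_verts n)" using f by (simp add: graph_auts_def Bij_def bij_betw_def)
  then show ?thesis using assms gvert_eq_iff[OF n3] gvert_in_iff[OF n3] by (metis inj_onD)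
qed

lemma aut_gvert_mem: "x \<le> 9 \<Longrightarrow> f (gvert n i x) \<in> G_verts n"
  using f gvert_in_iff[OF n3, of i x] by (auto simp: graph_auts_def Bij_def bij_betw_def)

lemma aut_fibre_step:
  assumes "x \<le> 9" "f (gvert n i x) = gvert n l y"
  obtains d where "d \<in> {1, -1}" "f (gvert n (i + 1) x) = gvert n (l + d) y"
proof -
  obtain k z where kz: "f (gvert n (i + 1) x) = gvert n k z"
    using gvert_cases[OF n3 aut_gvert_mem[OF assms(1)]] by metis
  have "three_common_nbrs (G_verts n) (G_edges n) (f (gvert n i x)) (f (gvert n (i + 1) x))"
    using assms(1) by (intro three_common_nbrs_aut[OF f] three_common_nbrs_gvert_Suc[OF n3])
      (simp_all add: gvert_in_iff[OF n3])
  then have "y = z \<and> (int n dvd k - l - 1 \<or> int n dvd k - l + 1)"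
    unfolding kz assms(2) by (rule three_common_nbrs_gvertD[OF n3])
  then have "f (gvert n (i + 1) x) = gvert n (l + 1) y \<or> f (gvert n (i + 1) x) = gvert n (l + (-1)) y"
    unfolding kz by (auto simp: gvert_eq_iff[OF n3] algebra_simps)
  then show thesis using that by blast
qed

text \<open>The direction \<open>d\<close> from \<open>aut_fibre_step\<close> could a priori vary
  with the layer, but a change of direction would identify the images of layers \<open>k\<close> and
  \<open>k + 2\<close>, forcing \<open>n\<close> to divide 2. The induction carries two consecutive
  values to compare directions.\<close>

lemma aut_on_fibre:
  assumes x: "x \<le> 9"
  shows "\<exists>s e y. e \<in> {1, -1} \<and> y \<le> 9 \<and> (\<forall>i. f (gvert n i x) = gvert n (s + e * i) y)"
proof -
  obtain s y where y: "y \<le> 9" "f (gvert n 0 x) = gvert n s y"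
    using gvert_cases[OF n3 aut_gvert_mem[OF x]] by metis
  obtain e where e: "e \<in> {1, -1}" "f (gvert n (0 + 1) x) = gvert n (s + e) y"
    using x y(2) by (rule aut_fibre_step)
  have "f (gvert n (int k) x) = gvert n (s + e * int k) y \<and>
      f (gvert n (int k + 1) x) = gvert n (s + e * (int k + 1)) y" for k
  proof (induction k)
    case 0
    then show ?case using y e by simp
  next
    case (Suc k)
    then obtain d where d: "d \<in> {1, -1}"
      "f (gvert n (int k + 1 + 1) x) = gvert n (s + e * (int k + 1) + d) y"
      using aut_fibre_step[OF x] by blast
    have "d = e"
    proof (rule ccontr)
      assume "d \<noteq> e"
      then have "d = - e" using d(1) e(1) by auto
      then have "f (gvert n (int k + 1 + 1) x) = f (gvert n (int k) x)"
        using d(2) Suc by (simp add: algebra_simps)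
      then have "int n dvd 2" by (simp add: aut_eq_iff[OF x x])
      then show False using n3 zdvd_imp_le[of "int n" 2] by simp
    qed
    then show ?case using d(2) Suc by (simp add: algebra_simps)
  qed
  then have nat: "f (gvert n (int k) x) = gvert n (s + e * int k) y" for k by blast
  have "f (gvert n i x) = gvert n (s + e * i) y" for i
  proof -
    define k where "k = nat (i mod int n)"
    have "int k = i mod int n" using n3 by (simp add: k_def)
    then have dvd: "int n dvd i - int k" by (simp add: minus_mod_eq_mult_div)
    then have eq: "gvert n i x = gvert n (int k) x" by (simp add: gvert_eq_iff[OF n3])
    have "int n dvd (s + e * int k) - (s + e * i)"
      using dvd_mult[OF dvd, of "- e"] by (simp add: algebra_simps)
    then have "gvert n (s + e * int k) y = gvert n (s + e * i) y" by (simp add: gvert_eq_iff[OF n3])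
    then show ?thesis using nat[of k] eq by simp
  qed
  then show ?thesis using e(1) y(1) by blast
qed

text \<open>The offsets 0 and \<open>arc_sign x y\<close> become \<open>t - s\<close> and
  \<open>t - s + e * arc_sign x y\<close>. Modulo \<open>n\<close> these must be 0 and
  \<open>arc_sign x' y'\<close> in some order, so their sum is known, and matching them one by one
  gives the congruence even modulo \<open>2 * n\<close>.\<close>

lemma aut_between_fibres:
  assumes fx: "\<And>i. f (gvert n i x) = gvert n (s + e * i) x'" "e \<in> {1, -1}"
    and fy: "\<And>i. f (gvert n i y) = gvert n (t + e' * i) y'" "e' \<in> {1, -1}"
    and xy: "y \<in> petersen_nbrs x"
  shows "y' \<in> petersen_nbrs x' \<and> e' = e \<and>
    2 * int n dvd 2 * (t - s) + e * arc_sign x y - arc_sign x' y'"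
proof -
  define c where "c = arc_sign x y"
  define d where "d = arc_sign x' y'"
  define u where "u = e' * c"
  have bounds: "x \<le> 9" "y \<le> 9"
    using xy petersen_nbrs_sym petersen_nbrs_bound[of x y] petersen_nbrs_bound[of y x] by auto
  have c: "c \<in> {1, -1}" using xy arc_sign_cases[of x y] by (auto simp: c_def petersen_nbrs_def)
  have adj: "y' \<in> petersen_nbrs x' \<and> (int n dvd (t + e' * j) - (s + e * i) \<or> int n dvd (t + e' * j) - (s + e * i) - d)"
    if "j = i \<or> j = i + c" for i j
  proof -
    have "{gvert n i x, gvert n j y} \<in> G_edges n"
      using that xy by (auto simp: gvert_adjacent_iff[OF n3] c_def)
    then have "{f (gvert n i x), f (gvert n j y)} \<in> G_edges n"
      using f bounds by (auto simp: graph_auts_def gvert_in_iff[OF n3])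
    then show ?thesis by (simp add: fx fy gvert_adjacent_iff[OF n3] d_def)
  qed
  have nbr: "y' \<in> petersen_nbrs x'" using adj[of 0 0] by simp
  then have d: "d \<in> {1, -1}" using arc_sign_cases[of x' y'] by (auto simp: d_def petersen_nbrs_def)
  have u: "u \<in> {1, -1}" using c fy(2) by (auto simp: u_def)
  have small: "\<not> int n dvd k" if "k \<in> {1, -1, 2, -2}" for k
    using n3 that zdvd_imp_le[of "int n" 1] zdvd_imp_le[of "int n" 2] by auto
  have A0: "int n dvd t - s \<or> int n dvd t - s - d" using adj[of 0 0] by simp
  have A1: "int n dvd t - s + u \<or> int n dvd t - s + u - d"
    using adj[of c 0] by (simp add: u_def algebra_simps)
  have diff: "\<not> (int n dvd a \<and> int n dvd b)" if "b - a \<in> {1, -1, 2, -2}" for a b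
    using small[OF that] dvd_diff[of "int n" b a] by blast
  \<comment> \<open>With opposite directions a third edge would give the offset
    \<open>t - s + 2 * u\<close>. Three pairwise incongruent numbers would then have to be congruent
    to 0 or \<open>d\<close>.\<close>
  have e: "e' = e"
  proof (rule ccontr)
    assume "e' \<noteq> e"
    then have "e = - e'" using fx(2) fy(2) by auto
    then have A2: "int n dvd t - s + 2 * u \<or> int n dvd t - s + 2 * u - d"
      using adj[of c c] by (simp add: u_def algebra_simps)
    show False
      using A0 A1 A2 u diff[of "t - s + u" "t - s"] diff[of "t - s + 2 * u" "t - s"]
        diff[of "t - s + 2 * u" "t - s + u"] diff[of "t - s + u - d" "t - s - d"]
        diff[of "t - s + 2 * u - d" "t - s - d"] diff[of "t - s + 2 * u - d" "t - s + u - d"]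
      by auto
  qed
  consider "int n dvd t - s" "int n dvd t - s + u - d" | "int n dvd t - s - d" "int n dvd t - s + u"
    using A0 A1 u diff[of "t - s + u" "t - s"] diff[of "t - s + u - d" "t - s - d"] by auto
  then have "2 * int n dvd 2 * (t - s) + u - d"
  proof cases
    case 1
    then have "u = d" using u d diff[of "t - s + u - d" "t - s"] by auto
    moreover have "2 * int n dvd 2 * (t - s)" using mult_dvd_mono[OF dvd_refl 1(1)] .
    ultimately show ?thesis by simp
  next
    case 2
    then have "u = - d" using u d diff[of "t - s + u" "t - s - d"] by auto
    moreover have "2 * int n dvd 2 * (t - s - d)" using mult_dvd_mono[OF dvd_refl 2(1)] .
    ultimately show ?thesis by (simp add: algebra_simps)
  qed
  then show ?thesis using nbr e by (simp add: u_def c_def d_def)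
qed

lemma aut_structure:
  obtains s :: "nat \<Rightarrow> int" and e :: int and p :: "nat \<Rightarrow> nat"
  where "e \<in> {1, -1}" "\<And>x. x \<le> 9 \<Longrightarrow> p x \<le> 9"
    "\<And>i x. x \<le> 9 \<Longrightarrow> f (gvert n i x) = gvert n (s x + e * i) (p x)"
    "\<And>x y. x \<le> 9 \<Longrightarrow> y \<le> 9 \<Longrightarrow> p x = p y \<Longrightarrow> x = y"
    "\<And>x y. y \<in> petersen_nbrs x \<Longrightarrow> p y \<in> petersen_nbrs (p x)"
    "\<And>x y. y \<in> petersen_nbrs x \<Longrightarrow>
      2 * int n dvd 2 * (s y - s x) + e * arc_sign x y - arc_sign (p x) (p y)"
proof -
  \<comment> \<open>Shift, direction and target fibre are packed into one triple so that a single
    choice suffices.\<close>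
  have "\<forall>x\<in>{..9}. \<exists>t. fst (snd t) \<in> {1, -1} \<and> snd (snd t) \<le> 9 \<and>
      (\<forall>i. f (gvert n i x) = gvert n (fst t + fst (snd t) * i) (snd (snd t)))"
  proof
    fix x :: nat assume "x \<in> {..9}"
    then obtain s e y where "e \<in> {1, -1}" "y \<le> 9" "\<forall>i. f (gvert n i x) = gvert n (s + e * i) y"
      using aut_on_fibre[of x] by auto
    then show "\<exists>t. fst (snd t) \<in> {1, -1} \<and> snd (snd t) \<le> 9 \<and>
        (\<forall>i. f (gvert n i x) = gvert n (fst t + fst (snd t) * i) (snd (snd t)))"
      by (intro exI[of _ "(s, e, y)"]) simp
  qed
  then obtain T where T: "\<forall>x\<in>{..9}. fst (snd (T x)) \<in> {1, -1} \<and> snd (snd (T x)) \<le> 9 \<and>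
      (\<forall>i. f (gvert n i x) = gvert n (fst (T x) + fst (snd (T x)) * i) (snd (snd (T x))))"
    by (rule bchoice[THEN exE])
  define s where "s x = fst (T x)" for x
  define E where "E x = fst (snd (T x))" for x
  define p where "p x = snd (snd (T x))" for x
  have E: "E x \<in> {1, -1}" and p: "p x \<le> 9"
    and fE: "f (gvert n i x) = gvert n (s x + E x * i) (p x)" if "x \<le> 9" for x i
    using T that by (simp_all add: s_def E_def p_def)
  have edge: "p y \<in> petersen_nbrs (p x) \<and> E y = E x \<and>
      2 * int n dvd 2 * (s y - s x) + E x * arc_sign x y - arc_sign (p x) (p y)"
    if "y \<in> petersen_nbrs x" for x y
  proof -
    have "x \<le> 9" "y \<le> 9"
      using that petersen_nbrs_sym petersen_nbrs_bound[of x y] petersen_nbrs_bound[of y x] by auto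
    then show ?thesis by (intro aut_between_fibres fE E that)
  qed
  \<comment> \<open>The direction is constant along edges, and the nine edges used form a spanning
    tree.\<close>
  have const: "E x = E 0" if "x \<le> 9" for x
  proof -
    have outer: "E 1 = E 0" "E 2 = E 1" "E 3 = E 2" "E 4 = E 0"
      by (simp_all add: edge petersen_nbrs_simps)
    have inner: "E 5 = E 0" "E 6 = E 1" "E 7 = E 2" "E 8 = E 3" "E 9 = E 4"
      by (simp_all add: edge petersen_nbrs_simps)
    have "x \<in> {0,1,2,3,4,5,6,7,8,9}" using that by auto
    then show ?thesis using outer inner by (elim insertE emptyE) simp_all
  qed
  show thesis
  proof (rule that[of "E 0" p s])
    fix x y assume xy: "x \<le> 9" "y \<le> 9" "p x = p y"
    \<comment> \<open>If two fibres had the same target, this layer of fibre \<open>x\<close> would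
      have the same image as layer 0 of fibre \<open>y\<close>; here \<open>E 0\<close> squares to
      1.\<close>
    have "s x + E 0 * (E 0 * (s y - s x)) = s y" using E[of 0] by auto
    then have "f (gvert n (E 0 * (s y - s x)) x) = f (gvert n 0 y)"
      unfolding fE[OF xy(1)] fE[OF xy(2)] const[OF xy(1)] xy(3) by simp
    then show "x = y" using aut_eq_iff[OF xy(1,2)] by blast
  next
    fix x y assume xy: "y \<in> petersen_nbrs x"
    have "x \<le> 9" using petersen_nbrs_bound[OF xy] by auto
    then have "E x = E 0" by (rule const)
    then show "2 * int n dvd 2 * (s y - s x) + E 0 * arc_sign x y - arc_sign (p x) (p y)"
      using edge[OF xy] by metis
  next
    fix i x assume "(x :: nat) \<le> 9"
    then show "f (gvert n i x) = gvert n (s x + E 0 * i) (p x)"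
      using fE[of x i] const[of x] by metis
  qed (use E p edge in simp_all)
qed

lemma aut_outer:
  assumes "x \<le> 4"
  shows "snd (f (gvert n i x)) \<le> 4"
proof -
  obtain s e p where e: "e \<in> {1, -1}"
    and f': "\<And>i x. x \<le> 9 \<Longrightarrow> f (gvert n i x) = gvert n (s x + e * i) (p x)"
    and adj: "\<And>x y. y \<in> petersen_nbrs x \<Longrightarrow> p y \<in> petersen_nbrs (p x)"
    and dvd: "\<And>x y. y \<in> petersen_nbrs x \<Longrightarrow>
      2 * int n dvd 2 * (s y - s x) + e * arc_sign x y - arc_sign (p x) (p y)"
    using aut_structure by metis
  define S where "S = arc_sign (p 0) (p 1) + arc_sign (p 1) (p 2) + arc_sign (p 2) (p 3) +
    arc_sign (p 3) (p 4) + arc_sign (p 4) (p 0)"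
  \<comment> \<open>Around the closed walk the increments of \<open>s\<close> telescope, leaving
    only the sign sums of the outer cycle and of its image.\<close>
  have "2 * int n dvd (2 * (s 1 - s 0) + e * arc_sign 0 1 - arc_sign (p 0) (p 1)) +
     (2 * (s 2 - s 1) + e * arc_sign 1 2 - arc_sign (p 1) (p 2)) +
     (2 * (s 3 - s 2) + e * arc_sign 2 3 - arc_sign (p 2) (p 3)) +
     (2 * (s 4 - s 3) + e * arc_sign 3 4 - arc_sign (p 3) (p 4)) +
     (2 * (s 0 - s 4) + e * arc_sign 4 0 - arc_sign (p 4) (p 0))"
    by (intro dvd_add dvd) (simp_all add: petersen_nbrs_simps)
  then have "2 * int n dvd 3 * e - S" by (simp add: S_def algebra_simps)
  \<comment> \<open>Here \<open>3 * e - S\<close> has absolute value 2 or 4, below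
    \<open>2 * n\<close>. The modulus \<open>n\<close> would not do for
    \<open>n = 4\<close>.\<close>
  moreover have "\<not> 2 * int n dvd 3 * e - S" if "\<bar>S\<bar> = 1"
    using that e n3 zdvd_imp_le[of "2 * int n" "\<bar>3 * e - S\<bar>"] by (auto simp: abs_if split: if_splits)
  ultimately have "\<bar>S\<bar> \<noteq> 1" by blast
  then have "{p 0, p 1, p 2, p 3, p 4} \<subseteq> {..4}"
    using petersen_five_cycle_sign_sum[of "p 1" "p 0" "p 2" "p 3" "p 4"]
    by (simp add: S_def adj petersen_nbrs_simps)
  moreover have "x \<in> {0,1,2,3,4}" using assms by auto
  ultimately have "p x \<le> 4" by auto
  then show ?thesis using f'[of x i] assms by (simp add: gvert_def)
qed

text \<open>Since \<open>p\<close> preserves the outer cycle, fixing 0 and 1 forces it to fix that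
  cycle pointwise, and then each inner vertex as the remaining neighbour of an outer one. It remains
  to show that \<open>e\<close> is 1 and that all shifts vanish modulo \<open>n\<close>.\<close>

lemma aut_rigid:
  assumes f0: "f (gvert n 0 0) = gvert n 0 0" and f1: "snd (f (gvert n 0 1)) = 1"
    and v: "v \<in> G_verts n"
  shows "f v = v"
proof -
  obtain s e p where e: "e \<in> {1, -1}"
    and f': "\<And>i x. x \<le> 9 \<Longrightarrow> f (gvert n i x) = gvert n (s x + e * i) (p x)"
    and inj: "\<And>x y. x \<le> 9 \<Longrightarrow> y \<le> 9 \<Longrightarrow> p x = p y \<Longrightarrow> x = y"
    and adj: "\<And>x y. y \<in> petersen_nbrs x \<Longrightarrow> p y \<in> petersen_nbrs (p x)"
    and dvd: "\<And>x y. y \<in> petersen_nbrs x \<Longrightarrow>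
      2 * int n dvd 2 * (s y - s x) + e * arc_sign x y - arc_sign (p x) (p y)"
    using aut_structure by metis
  have outer: "p x \<le> 4" if "x \<le> 4" for x
    using aut_outer[OF that, of 0] f'[of x 0] that by (simp add: gvert_def)
  have p0: "p 0 = 0" and s0: "int n dvd s 0"
    using f0 f'[of 0 0] by (auto simp: gvert_eq_iff[OF n3])
  have p1: "p 1 = 1" using f1 f'[of 1 0] by (simp add: gvert_def)
  have p2: "p 2 = 2" using adj[of 2 1] p1 outer[of 2] inj[of 2 0] p0 by (auto simp: petersen_nbrs_simps)
  have p3: "p 3 = 3" using adj[of 3 2] p2 outer[of 3] inj[of 3 1] p1 by (auto simp: petersen_nbrs_simps)
  have p4: "p 4 = 4" using adj[of 4 3] p3 outer[of 4] inj[of 4 2] p2 by (auto simp: petersen_nbrs_simps)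
  have p5: "p 5 = 5" using adj[of 5 0] p0 inj[of 5 1] inj[of 5 4] p1 p4 by (auto simp: petersen_nbrs_simps)
  have p6: "p 6 = 6" using adj[of 6 1] p1 inj[of 6 0] inj[of 6 2] p0 p2 by (auto simp: petersen_nbrs_simps)
  have p7: "p 7 = 7" using adj[of 7 2] p2 inj[of 7 1] inj[of 7 3] p1 p3 by (auto simp: petersen_nbrs_simps)
  have p8: "p 8 = 8" using adj[of 8 3] p3 inj[of 8 2] inj[of 8 4] p2 p4 by (auto simp: petersen_nbrs_simps)
  have p9: "p 9 = 9" using adj[of 9 4] p4 inj[of 9 0] inj[of 9 3] p0 p3 by (auto simp: petersen_nbrs_simps)
  have mem: "x \<in> {0,1,2,3,4,5,6,7,8,9}" if "x \<le> 9" for x :: nat using that by auto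
  have pid: "p x = x" if "x \<le> 9" for x
    using mem[OF that] p0 p1 p2 p3 p4 p5 p6 p7 p8 p9 by (elim insertE emptyE) simp_all
  have dvd': "2 * int n dvd 2 * (s y - s x) + e * arc_sign x y - arc_sign x y"
    if "y \<in> petersen_nbrs x" for x y
    using dvd[OF that] that pid petersen_nbrs_sym petersen_nbrs_bound[of x y] petersen_nbrs_bound[of y x]
    by auto
  \<comment> \<open>The inner cycle has sign sum 1 and yields \<open>e - 1\<close>. The outer cycle
    would yield only \<open>3 * (e - 1)\<close>, which is -6 for \<open>e = -1\<close> and so no
    contradiction for \<open>n = 3\<close>.\<close>
  have "2 * int n dvd (2 * (s 7 - s 5) + e * arc_sign 5 7 - arc_sign 5 7) +
     (2 * (s 9 - s 7) + e * arc_sign 7 9 - arc_sign 7 9) +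
     (2 * (s 6 - s 9) + e * arc_sign 9 6 - arc_sign 9 6) +
     (2 * (s 8 - s 6) + e * arc_sign 6 8 - arc_sign 6 8) +
     (2 * (s 5 - s 8) + e * arc_sign 8 5 - arc_sign 8 5)"
    by (intro dvd_add dvd') (simp_all add: petersen_nbrs_simps)
  then have "2 * int n dvd e - 1" by (simp add: algebra_simps)
  moreover have "\<not> 2 * int n dvd -2" using n3 zdvd_imp_le[of "2 * int n" 2] by auto
  ultimately have e1: "e = 1" using e by auto
  have "2 * int n dvd 2 * (s y - s x)" if "y \<in> petersen_nbrs x" for x y
    using dvd'[OF that] e1 by simp
  then have "int n dvd s y - s x" if "y \<in> petersen_nbrs x" for x y
    using that by (metis dvd_mult_cancel_left zero_neq_numeral)
  then have step: "int n dvd s y" if "int n dvd s x" "y \<in> petersen_nbrs x" for x y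
    using that by (metis diff_add_cancel dvd_add)
  have outer_s: "int n dvd s 1" "int n dvd s 4" "int n dvd s 5"
    using step[OF s0] by (simp_all add: petersen_nbrs_simps)
  have outer_s': "int n dvd s 2" "int n dvd s 6" "int n dvd s 3" "int n dvd s 9" "int n dvd s 7" "int n dvd s 8"
    using step[OF outer_s(1)] step[OF outer_s(2)] step[OF outer_s(3)] by (simp_all add: petersen_nbrs_simps)
  have s: "int n dvd s x" if "x \<le> 9" for x
    using mem[OF that] s0 outer_s outer_s' by (elim insertE emptyE) simp_all
  obtain i x where "v = gvert n i x" "x \<le> 9" using gvert_cases[OF n3 v] .
  then show ?thesis using f' pid e1 s by (simp add: gvert_eq_iff[OF n3])
qed

end

section \<open>Every automorphism is dihedral\<close>

lemma graph_auts_compose: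
  assumes "f \<in> graph_auts V E" "g \<in> graph_auts V E"
  shows "compose V f g \<in> graph_auts V E"
proof -
  interpret group "Aut_graph V E" by (rule group_Aut_graph)
  have "f \<otimes>\<^bsub>Aut_graph V E\<^esub> g \<in> carrier (Aut_graph V E)"
    using assms by (intro m_closed) (simp_all add: Aut_graph_def)
  then show ?thesis using assms by (simp add: Aut_graph_def BijGroup_def graph_auts_def)
qed

context
  fixes n :: nat
  assumes n3: "n \<ge> 3"
begin

lemma bvert_outer: "snd (bvert n False m) = nat (m mod 5)"
  by (simp add: bvert_def gvert_def)

lemma bvert_outer_cases:
  assumes "v \<in> G_verts n" "snd v \<le> 4"
  obtains m where "v = bvert n False m" "m mod 5 = int (snd v)"
proof -
  obtain b m where v: "v = bvert n b m" using bvert_cases[OF n3 assms(1)] .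
  have "\<not> b" using assms(2) v by (auto simp: bvert_def gvert_def)
  then show thesis using that[of m] v by (simp add: bvert_outer)
qed

lemma stabilizer_undone_by_dihedral:
  assumes f: "f \<in> graph_auts (G_verts n) (G_edges n)" and f0: "f (gvert n 0 0) = gvert n 0 0"
  shows "\<exists>g\<in>carrier (dihedral_group (5 * n)). \<forall>v\<in>G_verts n. dmap n g (f v) = v"
proof -
  have in_verts: "gvert n 0 0 \<in> G_verts n" "gvert n 0 1 \<in> G_verts n"
    by (simp_all add: gvert_in_iff[OF n3])
  have carr: "(0, s) \<in> carrier (dihedral_group (5 * n))" for s
    using n3 by (simp add: dihedral_group_def)
  have fV: "f v \<in> G_verts n" if "v \<in> G_verts n" for v
    using f that by (auto simp: graph_auts_def Bij_def bij_betw_def)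
  obtain l y where y: "f (gvert n 0 1) = gvert n l y" using gvert_cases[OF n3 fV[OF in_verts(2)]] by metis
  have "{gvert n 0 0, gvert n 0 1} \<in> G_edges n"
    by (simp add: gvert_adjacent_iff[OF n3] petersen_nbrs_simps)
  then have "{f (gvert n 0 0), f (gvert n 0 1)} \<in> G_edges n"
    using f in_verts by (auto simp: graph_auts_def)
  then have "y \<in> {1, 4, 5}"
    unfolding f0 y gvert_adjacent_iff[OF n3] petersen_nbrs_simps by blast
  \<comment> \<open>Preservation of the outer cycle excludes the spoke neighbour 5.\<close>
  moreover have "y \<le> 4" using aut_outer[OF n3 f, of 1 0] y by (simp add: gvert_def)
  ultimately consider "y = 1" | "y = 4" by auto
  then show ?thesis
  proof cases
    case 1
    then have "f v = v" if "v \<in> G_verts n" for v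
      using that y by (intro aut_rigid[OF n3 f f0]) (simp_all add: gvert_def)
    then show ?thesis using dmap_one[OF n3] carr by (intro bexI[of _ "(0, False)"]) auto
  next
    case 2
    \<comment> \<open>The reflection negating the indices of the \<open>a\<close>-vertices fixes
      index 0 and exchanges the fibres 1 and 4, which reduces this case to the previous one.\<close>
    define h where "h = compose (G_verts n) (dmap n (0, True)) f"
    have h: "h \<in> graph_auts (G_verts n) (G_edges n)"
      unfolding h_def by (intro graph_auts_compose f dmap_in_graph_auts[OF n3] carr)
    have "gvert n 0 0 = bvert n False 0" by (simp add: bvert_def)
    then have h0: "h (gvert n 0 0) = gvert n 0 0"
      using in_verts f0 by (simp add: h_def compose_eq dmap_bvert[OF n3] dact_def)
    have "gvert n l y \<in> G_verts n" "snd (gvert n l y) \<le> 4"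
      using fV[OF in_verts(2)] y \<open>y \<le> 4\<close> by (simp_all add: gvert_def)
    then obtain m where m: "gvert n l y = bvert n False m" "m mod 5 = int (snd (gvert n l y))"
      by (rule bvert_outer_cases)
    have "m mod 5 = 4" using m(2) 2 by (simp add: gvert_def)
    then have "(- m) mod 5 = 1" by presburger
    then have "snd (h (gvert n 0 1)) = 1"
      using in_verts y m(1) by (simp add: h_def compose_eq dmap_bvert[OF n3] dact_def bvert_outer)
    then have "h v = v" if "v \<in> G_verts n" for v
      using aut_rigid[OF n3 h h0] that by blast
    then show ?thesis using carr by (intro bexI[of _ "(0, True)"]) (auto simp: h_def compose_eq)
  qed
qed

text \<open>\<open>aut_outer\<close> puts the image of the base vertex among the
  \<open>a\<close>-vertices, so a rotation brings it back and leaves an automorphism fixing the base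
  vertex.\<close>

lemma aut_undone_by_dihedral:
  assumes f: "f \<in> graph_auts (G_verts n) (G_edges n)"
  shows "\<exists>g\<in>carrier (dihedral_group (5 * n)). \<forall>v\<in>G_verts n. dmap n g (f v) = v"
proof -
  interpret D: group "dihedral_group (5 * n)" using n3 by (intro group_dihedral_group) simp
  have v0: "gvert n 0 0 \<in> G_verts n" by (simp add: gvert_in_iff[OF n3])
  have fV: "f v \<in> G_verts n" if "v \<in> G_verts n" for v
    using f that by (auto simp: graph_auts_def Bij_def bij_betw_def)
  obtain c where c: "f (gvert n 0 0) = bvert n False c"
    using bvert_outer_cases[OF fV[OF v0] aut_outer[OF n3 f, of 0 0]] by blast
  define g where "g = ((- c) mod int (5 * n), False)"
  have g: "g \<in> carrier (dihedral_group (5 * n))" using n3 by (simp add: g_def dihedral_group_def)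
  define h where "h = compose (G_verts n) (dmap n g) f"
  have h: "h \<in> graph_auts (G_verts n) (G_edges n)"
    unfolding h_def by (intro graph_auts_compose f dmap_in_graph_auts[OF n3] g)
  have "int (5 * n) dvd (- c) mod int (5 * n) - (- c)" by (metis mod_eq_dvd_iff mod_mod_trivial)
  then have "bvert n False (dact g False c) = bvert n False 0"
    by (simp add: bvert_eq_iff[OF n3] g_def dact_def)
  also have "\<dots> = gvert n 0 0" by (simp add: bvert_def)
  finally have "h (gvert n 0 0) = gvert n 0 0"
    using v0 c by (simp add: h_def compose_eq dmap_bvert[OF n3])
  then obtain k where k: "k \<in> carrier (dihedral_group (5 * n))" "\<forall>v\<in>G_verts n. dmap n k (h v) = v"
    using stabilizer_undone_by_dihedral[OF h] by blast
  have "dmap n (k \<otimes>\<^bsub>dihedral_group (5 * n)\<^esub> g) (f v) = v" if "v \<in> G_verts n" for v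
    using k(2) that dmap_mult[OF n3 fV[OF that], of k g] by (simp add: h_def compose_eq)
  then show ?thesis using D.m_closed[OF k(1) g] by blast
qed

lemma dmap_surj: "graph_auts (G_verts n) (G_edges n) \<subseteq> dmap n ` carrier (dihedral_group (5 * n))"
proof
  fix f assume f: "f \<in> graph_auts (G_verts n) (G_edges n)"
  interpret D: group "dihedral_group (5 * n)" using n3 by (intro group_dihedral_group) simp
  obtain g where g: "g \<in> carrier (dihedral_group (5 * n))" "\<forall>v\<in>G_verts n. dmap n g (f v) = v"
    using aut_undone_by_dihedral[OF f] by blast
  define h where "h = inv\<^bsub>dihedral_group (5 * n)\<^esub> g"
  have "f v = dmap n h v" if v: "v \<in> G_verts n" for v
  proof -
    have fv: "f v \<in> G_verts n" using f v by (auto simp: graph_auts_def Bij_def bij_betw_def)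
    have "dmap n h (dmap n g (f v)) = dmap n (0, False) (f v)"
      using dmap_mult[OF n3 fv, of h g] D.l_inv[OF g(1)] by (simp add: h_def dihedral_group_def)
    then show ?thesis using g(2) v dmap_one[OF n3 fv] by simp
  qed
  moreover have "f \<in> extensional (G_verts n)" using f by (simp add: graph_auts_def Bij_def)
  moreover have "dmap n h \<in> extensional (G_verts n)" by (simp add: dmap_def)
  ultimately have "f = dmap n h" by (intro extensionalityI)
  then show "f \<in> dmap n ` carrier (dihedral_group (5 * n))" using g(1) by (simp add: h_def)
qed

end

theorem theorem4p1:
  fixes n :: nat
  assumes "n \<ge> 3"
  shows "Aut_graph (G_verts n) (G_edges n) \<cong> dihedral_group (5 * n)"
proof -
  interpret D: group "dihedral_group (5 * n)" using assms by (intro group_dihedral_group) simp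
  have "dmap n ` carrier (dihedral_group (5 * n)) = graph_auts (G_verts n) (G_edges n)"
    using dmap_surj[OF assms] dmap_in_graph_auts[OF assms] by blast
  then have "dmap n \<in> iso (dihedral_group (5 * n)) (Aut_graph (G_verts n) (G_edges n))"
    using dmap_hom[OF assms] dmap_inj[OF assms] by (simp add: iso_def bij_betw_def Aut_graph_def)
  then show ?thesis using D.iso_sym by (auto simp: is_iso_def)
qed

end
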